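(* Let $F$ be a field of characteristic different from $2$, let $n\geq 3$, and let $UT_n=UT_n(F)$ be endowed with the reflexive involution $r$. Then the image of the multilinear polynomial $f(z_1,z_2)=z_1z_2$ in skew-symmetric variables on $UT_n$, that is, the set $\{AB : A,B\in\mathcal{K}\}$ where $\mathcal{K}=\{A\in UT_n: A^r=-A\}$, is not a vector space.
   Context: $UT_n(F)$ is the algebra of $n\times n$ upper triangular matrices over $F$. The reflexive involution on $UT_n$ is $A^{r}=JA^{t}J$, where $A^t$ is the transpose and $J=e_{1n}+e_{2,n-1}+\cdots+e_{n1}$ ($e_{ij}$ are the matrix units), i.e. the linear map with $e_{ij}\mapsto e_{n+1-j,n+1-i}$. Variables denoted $z_i$ are evaluated on skew-symmetric elements. *)

theory Defs
  imports "Jordan_Normal_Form.VS_Connect"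
begin

definition UT :: "nat \<Rightarrow> 'a::field mat set" where
  "UT n = {A \<in> carrier_mat n n. upper_triangular A}"

(* Matrix indices start at 0 here, so the antidiagonal i + j = n + 1 becomes i + j + 1 = n. *)
definition exchange_mat :: "nat \<Rightarrow> 'a::field mat" where
  "exchange_mat n = mat n n (\<lambda>(i, j). if i + j + 1 = n then 1 else 0)"

definition reflexive_inv :: "nat \<Rightarrow> 'a::field mat \<Rightarrow> 'a mat" where
  "reflexive_inv n A = exchange_mat n * transpose_mat A * exchange_mat n"

definition skew_UT :: "nat \<Rightarrow> 'a::field mat set" where
  "skew_UT n = {A \<in> UT n. reflexive_inv n A = - A}"

definition image_z1z2 :: "nat \<Rightarrow> 'a::field mat set" where
  "image_z1z2 n = {A * B | A B. A \<in> skew_UT n \<and> B \<in> skew_UT n}"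

end

theory Submission
  imports Defs
begin

text \<open>
  The product of two skew-symmetric elements determines its own reflection: the involution reverses
  products, so \<open>(AB)\<^sup>r = (-B)(-A) = BA\<close>.  Hence if the product \<open>S = AB\<close> is itself symmetric, then
  \<open>A\<close> and \<open>B\<close> commute, and therefore \<open>A\<close> commutes with \<open>S\<close>.  This makes symmetric elements of the
  image rigid, and the matrix
  \<open>S = e\<^sub>1\<^sub>1 + e\<^sub>n\<^sub>n + e\<^sub>1\<^sub>n\<close> violates it: comparing the corner entries of \<open>AS\<close> and \<open>SA\<close> gives
  \<open>a\<^sub>1\<^sub>1 + a\<^sub>1\<^sub>n = a\<^sub>1\<^sub>n + a\<^sub>n\<^sub>n\<close>, while skewness forces \<open>a\<^sub>n\<^sub>n = -a\<^sub>1\<^sub>1\<close>.  So \<open>2 a\<^sub>1\<^sub>1 = 0\<close>, which is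
  impossible in characteristic other than 2 because \<open>a\<^sub>1\<^sub>1\<close> divides the entry \<open>1\<close> of \<open>S\<close>
  (lemma \<open>corner_sum_notin_image\<close>).

  On the other hand \<open>S\<close> is a sum of two elements of the image:
  \<open>e\<^sub>1\<^sub>1 + e\<^sub>n\<^sub>n = (e\<^sub>1\<^sub>1 - e\<^sub>n\<^sub>n)\<^sup>2\<close>, and \<open>e\<^sub>1\<^sub>n\<close> is the product of
  \<open>e\<^sub>1\<^sub>2 - e\<^bsub>n-1,n\<^esub>\<close> and \<open>e\<^sub>2\<^sub>n - e\<^bsub>1,n-1\<^esub>\<close> when \<open>n \<ge> 3\<close>
  (lemma \<open>corner_sum_decomposition\<close>).  Thus the image is not closed under addition.
  In the code, indices start at \<open>0\<close>.
\<close>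

section \<open>The reflexive involution\<close>

lemma exchange_mat_carrier [simp]: "exchange_mat n \<in> carrier_mat n n"
  by (simp add: exchange_mat_def)

lemma exchange_mult_index:
  assumes "M \<in> carrier_mat n n" "i < n" "j < n"
  shows "(exchange_mat n * M) $$ (i, j) = M $$ (n - 1 - i, j)"
proof -
  have "(exchange_mat n * M) $$ (i, j)
      = (\<Sum>k\<in>{0..<n}. (if i + k + 1 = n then 1 else 0) * M $$ (k, j))"
    using assms by (auto simp: exchange_mat_def scalar_prod_def intro!: sum.cong)
  also have "\<dots> = (\<Sum>k\<in>{0..<n}. if k = n - 1 - i then M $$ (k, j) else 0)"
    using assms by (intro sum.cong) auto
  finally show ?thesis
    using assms by simp
qed

lemma mult_exchange_index:
  assumes "M \<in> carrier_mat n n" "i < n" "j < n"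
  shows "(M * exchange_mat n) $$ (i, j) = M $$ (i, n - 1 - j)"
proof -
  have "(M * exchange_mat n) $$ (i, j)
      = (\<Sum>k\<in>{0..<n}. M $$ (i, k) * (if k + j + 1 = n then 1 else 0))"
    using assms by (auto simp: exchange_mat_def scalar_prod_def intro!: sum.cong)
  also have "\<dots> = (\<Sum>k\<in>{0..<n}. if k = n - 1 - j then M $$ (i, k) else 0)"
    using assms by (intro sum.cong) auto
  finally show ?thesis
    using assms by simp
qed

lemma exchange_mat_square: "exchange_mat n * exchange_mat n = 1\<^sub>m n"
proof (rule eq_matI)
  fix i j assume "i < dim_row (1\<^sub>m n)" "j < dim_col (1\<^sub>m n)"
  then show "(exchange_mat n * exchange_mat n) $$ (i, j) = 1\<^sub>m n $$ (i, j)"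
    by (subst exchange_mult_index) (auto simp: exchange_mat_def)
qed (auto simp: exchange_mat_def)

lemma reflexive_inv_dim [simp]:
  "dim_row (reflexive_inv n A) = n" "dim_col (reflexive_inv n A) = n"
  by (simp_all add: reflexive_inv_def exchange_mat_def)

lemma reflexive_inv_index:
  assumes "A \<in> carrier_mat n n" "i < n" "j < n"
  shows "reflexive_inv n A $$ (i, j) = A $$ (n - 1 - j, n - 1 - i)"
  unfolding reflexive_inv_def using assms
  by (subst mult_exchange_index) (auto simp: exchange_mult_index[where n = n] simp del: index_mult_mat(1)
      intro!: mult_carrier_mat[where n = n])

text \<open>Inserting \<open>J\<^sup>2 = 1\<close> between the transposed factors splits the conjugate of the product.\<close>

lemma reflexive_inv_mult:
  assumes A: "A \<in> carrier_mat n n" and B: "B \<in> carrier_mat n n"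
  shows "reflexive_inv n (A * B) = reflexive_inv n B * reflexive_inv n A"
proof -
  let ?J = "exchange_mat n :: 'a mat" and ?A = "transpose_mat A" and ?B = "transpose_mat B"
  have J: "?J \<in> carrier_mat n n" and At: "?A \<in> carrier_mat n n" and Bt: "?B \<in> carrier_mat n n"
    using A B by auto
  have JB: "?J * ?B \<in> carrier_mat n n" and AJ: "?A * ?J \<in> carrier_mat n n"
    by (rule mult_carrier_mat[OF J Bt], rule mult_carrier_mat[OF At J])
  have "(?J * ?B * ?J) * (?J * ?A * ?J) = (?J * ?B) * (?J * (?J * (?A * ?J)))"
    using assoc_mult_mat[OF JB J, of "?J * ?A * ?J" n] assoc_mult_mat[OF J At J] J AJ by auto
  also have "?J * (?J * (?A * ?J)) = ?A * ?J"
    using assoc_mult_mat[OF J J AJ] left_mult_one_mat[OF AJ] exchange_mat_square by metis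
  also have "(?J * ?B) * (?A * ?J) = ?J * (?B * ?A) * ?J"
    using assoc_mult_mat[OF JB At J] assoc_mult_mat[OF J Bt At] by simp
  finally show ?thesis
    using transpose_mult[OF A B] by (simp add: reflexive_inv_def)
qed

section \<open>Products of skew-symmetric elements\<close>

lemma skew_UT_carrier: "A \<in> skew_UT n \<Longrightarrow> A \<in> carrier_mat n n"
  by (simp add: skew_UT_def UT_def)

lemma skew_UT_index:
  assumes "A \<in> skew_UT n" "i < n" "j < n"
  shows "A $$ (n - 1 - j, n - 1 - i) = - A $$ (i, j)"
proof -
  have "reflexive_inv n A $$ (i, j) = (- A) $$ (i, j)"
    using assms by (simp add: skew_UT_def)
  then show ?thesis
    using assms skew_UT_carrier[OF assms(1)] by (simp add: reflexive_inv_index)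
qed

text \<open>The involution reverses the product, and the two signs cancel.\<close>

lemma skew_mult_reflexive_inv:
  assumes "A \<in> skew_UT n" "B \<in> skew_UT n"
  shows "reflexive_inv n (A * B) = B * A"
proof -
  have "reflexive_inv n (A * B) = (- B) * (- A)"
    using assms by (simp add: reflexive_inv_mult[OF skew_UT_carrier skew_UT_carrier] skew_UT_def)
  also have "\<dots> = B * A"
    using skew_UT_carrier[OF assms(1)] skew_UT_carrier[OF assms(2)] by simp
  finally show ?thesis .
qed

lemma skew_commutes_with_symmetric_product:
  assumes A: "A \<in> skew_UT n" and B: "B \<in> skew_UT n"
    and sym: "reflexive_inv n (A * B) = A * B"
  shows "A * (A * B) = (A * B) * A"
proof -
  have "B * A = A * B"
    using skew_mult_reflexive_inv[OF A B] sym by simp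
  then show ?thesis
    using skew_UT_carrier[OF A] skew_UT_carrier[OF B] by (metis assoc_mult_mat)
qed

section \<open>A sum of two products that is not a product\<close>

text \<open>The matrix \<open>e\<^sub>0\<^sub>0 + e\<^bsub>n-1,n-1\<^esub> + e\<^bsub>0,n-1\<^esub>\<close>, for \<open>n \<ge> 2\<close>.\<close>

definition corner_sum :: "nat \<Rightarrow> 'a::field mat" where
  "corner_sum n = mat n n (\<lambda>(i, j). if (i = 0 \<or> i = n - 1) \<and> (j = i \<or> j = n - 1) then 1 else 0)"

lemma corner_sum_carrier [simp]: "corner_sum n \<in> carrier_mat n n"
  by (simp add: corner_sum_def)

lemma corner_sum_symmetric: "reflexive_inv n (corner_sum n) = corner_sum n"
proof (rule eq_matI)
  fix i j assume "i < dim_row (corner_sum n)" "j < dim_col (corner_sum n)"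
  then have "i < n" "j < n"
    by (auto simp: corner_sum_def)
  then show "reflexive_inv n (corner_sum n) $$ (i, j) = corner_sum n $$ (i, j)"
    by (auto simp: reflexive_inv_index corner_sum_def)
qed (simp_all add: corner_sum_def)

lemma corner_sum_commutator_index:
  assumes A: "A \<in> carrier_mat n n" and n: "n \<ge> 2"
  shows "(A * corner_sum n) $$ (0, n - 1) = A $$ (0, 0) + A $$ (0, n - 1)"
    and "(corner_sum n * A) $$ (0, n - 1) = A $$ (0, n - 1) + A $$ (n - 1, n - 1)"
proof -
  have "(A * corner_sum n) $$ (0, n - 1)
      = (\<Sum>k\<in>{0..<n}. if k \<in> {0, n - 1} then A $$ (0, k) else 0)"
    using assms by (auto simp: corner_sum_def scalar_prod_def intro!: sum.cong)
  also have "\<dots> = (\<Sum>k\<in>{0, n - 1}. A $$ (0, k))"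
    using n by (intro sum.mono_neutral_cong_right) auto
  finally show "(A * corner_sum n) $$ (0, n - 1) = A $$ (0, 0) + A $$ (0, n - 1)"
    using n by simp
  have "(corner_sum n * A) $$ (0, n - 1)
      = (\<Sum>k\<in>{0..<n}. if k \<in> {0, n - 1} then A $$ (k, n - 1) else 0)"
    using assms by (auto simp: corner_sum_def scalar_prod_def intro!: sum.cong)
  also have "\<dots> = (\<Sum>k\<in>{0, n - 1}. A $$ (k, n - 1))"
    using n by (intro sum.mono_neutral_cong_right) auto
  finally show "(corner_sum n * A) $$ (0, n - 1) = A $$ (0, n - 1) + A $$ (n - 1, n - 1)"
    using n by simp
qed

text \<open>Both factors are upper triangular, so the top-left entry of a product is multiplicative.\<close>

lemma skew_mult_index_00:
  assumes A: "A \<in> skew_UT n" and B: "B \<in> skew_UT n" and n: "n > 0"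
  shows "(A * B) $$ (0, 0) = A $$ (0, 0) * B $$ (0, 0)"
proof -
  have lower: "B $$ (k, 0) = 0" if "0 < k" "k < n" for k
    using B that by (auto simp: skew_UT_def UT_def upper_triangular_def)
  have "(A * B) $$ (0, 0) = (\<Sum>k\<in>{0..<n}. A $$ (0, k) * B $$ (k, 0))"
    using skew_UT_carrier[OF A] skew_UT_carrier[OF B] n
    by (auto simp: scalar_prod_def intro!: sum.cong)
  also have "\<dots> = (\<Sum>k\<in>{0}. A $$ (0, k) * B $$ (k, 0))"
    using n lower by (intro sum.mono_neutral_right) auto
  finally show ?thesis
    by simp
qed

lemma two_neq_zero_of_CHAR:
  assumes "CHAR('a::field) \<noteq> 2"
  shows "(2 :: 'a) \<noteq> 0"
proof
  assume "(2 :: 'a) = 0"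
  then have "of_nat 2 = (0 :: 'a)"
    by simp
  then have "CHAR('a) dvd 2"
    by (simp only: of_nat_eq_0_iff_char_dvd)
  then have "CHAR('a) = 1 \<or> CHAR('a) = 2"
    using two_is_prime_nat unfolding prime_nat_iff by blast
  then show False
    using assms by simp
qed

text \<open>
  A factorization would consist of factors commuting with \<open>corner_sum n\<close>.  The corner entry of the
  commutator then equates the first and last diagonal entries of a factor, which skewness makes
  opposite.
\<close>

lemma corner_sum_notin_image:
  assumes char: "CHAR('a::field) \<noteq> 2" and n: "n \<ge> 2"
  shows "corner_sum n \<notin> (image_z1z2 n :: 'a mat set)"
proof
  assume "corner_sum n \<in> (image_z1z2 n :: 'a mat set)"
  then obtain A B :: "'a mat" where AB: "corner_sum n = A * B" and A: "A \<in> skew_UT n"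
    and B: "B \<in> skew_UT n"
    by (auto simp: image_z1z2_def)
  have "A * corner_sum n = corner_sum n * A"
    using skew_commutes_with_symmetric_product[OF A B] corner_sum_symmetric[of n, where ?'a = 'a]
    by (simp add: AB)
  then have "A $$ (0, 0) + A $$ (0, n - 1) = A $$ (0, n - 1) + A $$ (n - 1, n - 1)"
    using corner_sum_commutator_index[OF skew_UT_carrier[OF A] n] by simp
  moreover have "A $$ (n - 1, n - 1) = - A $$ (0, 0)"
    using skew_UT_index[OF A, of 0 0] n by simp
  ultimately have "2 * A $$ (0, 0) = 0"
    by (simp add: algebra_simps)
  then have "A $$ (0, 0) = 0"
    using two_neq_zero_of_CHAR[OF char] by simp
  moreover have "A $$ (0, 0) * B $$ (0, 0) = 1"
    using skew_mult_index_00[OF A B] n by (simp add: AB[symmetric] corner_sum_def)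
  ultimately show False
    by simp
qed

text \<open>
  The skew-symmetrization \<open>e\<^sub>a\<^sub>b - (e\<^sub>a\<^sub>b)\<^sup>r\<close> of a matrix unit.
\<close>

definition skew_unit :: "nat \<Rightarrow> nat \<Rightarrow> nat \<Rightarrow> 'a::field mat" where
  "skew_unit n a b = mat n n (\<lambda>(i, j). (if i = a \<and> j = b then 1 else 0)
     - (if i = n - 1 - b \<and> j = n - 1 - a then 1 else 0))"

lemma skew_unit_carrier [simp]: "skew_unit n a b \<in> carrier_mat n n"
  by (simp add: skew_unit_def)

lemma skew_unit_skew:
  assumes "a \<le> b" "b < n"
  shows "skew_unit n a b \<in> skew_UT n"
proof -
  have "reflexive_inv n (skew_unit n a b) = - (skew_unit n a b :: 'a mat)"
  proof (rule eq_matI)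
    fix i j assume "i < dim_row (- skew_unit n a b :: 'a mat)" "j < dim_col (- skew_unit n a b :: 'a mat)"
    then have ij: "i < n" "j < n"
      by (auto simp: skew_unit_def)
    have "n - 1 - j = a \<longleftrightarrow> j = n - 1 - a" "n - 1 - i = b \<longleftrightarrow> i = n - 1 - b"
      "n - 1 - j = n - 1 - b \<longleftrightarrow> j = b" "n - 1 - i = n - 1 - a \<longleftrightarrow> i = a"
      using ij assms by linarith+
    then have "(skew_unit n a b :: 'a mat) $$ (n - 1 - j, n - 1 - i)
        = (if j = n - 1 - a \<and> i = n - 1 - b then 1 else 0) - (if j = b \<and> i = a then 1 else 0)"
      using ij by (simp add: skew_unit_def)
    also have "\<dots> = (- skew_unit n a b :: 'a mat) $$ (i, j)"
      using ij by (simp add: skew_unit_def conj_commute)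
    finally show "reflexive_inv n (skew_unit n a b) $$ (i, j) = (- skew_unit n a b :: 'a mat) $$ (i, j)"
      using ij by (simp only: reflexive_inv_index[OF skew_unit_carrier])
  qed (simp_all add: skew_unit_def)
  moreover have "upper_triangular (skew_unit n a b :: 'a mat)"
  proof (rule upper_triangularI)
    fix i j assume ij: "j < i" "i < dim_row (skew_unit n a b :: 'a mat)"
    then have "i < n" "j < n"
      by (auto simp: skew_unit_def)
    moreover have "\<not> (i = a \<and> j = b)" "\<not> (i = n - 1 - b \<and> j = n - 1 - a)"
      using ij assms by linarith+
    ultimately show "(skew_unit n a b :: 'a mat) $$ (i, j) = 0"
      unfolding skew_unit_def by (simp only: index_mat case_prod_conv if_False diff_self)
  qed
  ultimately show ?thesis
    by (simp add: skew_UT_def UT_def)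
qed

lemma skew_unit_mult_index:
  assumes M: "(M :: 'a::field mat) \<in> carrier_mat n n" and "i < n" "j < n" "a < n" "b < n"
  shows "(skew_unit n a b * M) $$ (i, j)
    = (if i = a then M $$ (b, j) else 0) - (if i = n - 1 - b then M $$ (n - 1 - a, j) else 0)"
proof -
  \<comment> \<open>Nesting the conditions isolates the one on the summation index, as \<open>sum.delta\<close> requires.\<close>
  have distrib: "((if P \<and> Q then 1 else 0) - (if R \<and> S then 1 else 0)) * x
      = (if Q then if P then x else 0 else 0) - (if S then if R then x else 0 else 0)"
    for P Q R S and x :: 'a
    by simp
  have "(skew_unit n a b * M) $$ (i, j) = (\<Sum>k\<in>{0..<n}. skew_unit n a b $$ (i, k) * M $$ (k, j))"
    using assms(2,3) M by (simp add: scalar_prod_def carrier_matD[OF skew_unit_carrier])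
  also have "\<dots> = (\<Sum>k\<in>{0..<n}. (if k = b then if i = a then M $$ (k, j) else 0 else 0)
          - (if k = n - 1 - a then if i = n - 1 - b then M $$ (k, j) else 0 else 0))"
    using assms by (intro sum.cong refl) (simp only: skew_unit_def index_mat case_prod_conv distrib
        atLeastLessThan_iff)
  also have "\<dots> = (if i = a then M $$ (b, j) else 0)
      - (if i = n - 1 - b then M $$ (n - 1 - a, j) else 0)"
    using assms by (simp add: sum_subtractf)
  finally show ?thesis .
qed

text \<open>
  For \<open>n \<ge> 3\<close> the last index differs from \<open>0\<close> and \<open>1\<close>, so the only surviving term of the second
  product is \<open>e\<^sub>0\<^sub>1 e\<^bsub>1,n-1\<^esub> = e\<^bsub>0,n-1\<^esub>\<close>.  For \<open>n = 2\<close> the position \<open>(0, 1)\<close> lies on the antidiagonal, where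
  every skew-symmetric matrix vanishes in characteristic other than 2.
\<close>

lemma corner_sum_decomposition:
  assumes n: "n \<ge> 3"
  shows "corner_sum n = skew_unit n 0 0 * skew_unit n 0 0
    + skew_unit n 0 1 * (skew_unit n 1 (n - 1) :: 'a::field mat)"
    (is "_ = ?D * ?D + ?P * ?Q")
proof (rule eq_matI)
  fix i j assume "i < dim_row (?D * ?D + ?P * ?Q)" "j < dim_col (?D * ?D + ?P * ?Q)"
  then have ij: "i < n" "j < n"
    by (auto simp: skew_unit_def)
  \<comment> \<open>In successor form the truncated differences \<open>n - 1\<close> and \<open>n - 1 - 1\<close> simplify to constructor terms.\<close>
  obtain m where m: "n = Suc (Suc (Suc m))"
    using n by (metis add_Suc le_Suc_ex numeral_3_eq_3)
  have "(?D * ?D + ?P * ?Q) $$ (i, j) = (?D * ?D) $$ (i, j) + (?P * ?Q) $$ (i, j)"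
    using ij by (intro index_add_mat(1)) (auto simp: skew_unit_def)
  also have "(?D * ?D) $$ (i, j) = (if i = j \<and> (i = 0 \<or> i = n - 1) then 1 else 0)"
    using ij unfolding m by (subst skew_unit_mult_index) (auto simp: skew_unit_def)
  also have "(?P * ?Q) $$ (i, j) = (if i = 0 \<and> j = n - 1 then 1 else 0)"
    using ij unfolding m by (subst skew_unit_mult_index) (auto simp: skew_unit_def)
  finally show "corner_sum n $$ (i, j) = (?D * ?D + ?P * ?Q) $$ (i, j)"
    using ij unfolding m
    by (cases "i = 0"; cases "i = Suc (Suc m)") (simp_all add: corner_sum_def)
qed (auto simp: corner_sum_def skew_unit_def)

theorem proposition4p1:
  fixes n :: nat
  assumes "CHAR('a::field) \<noteq> 2"
    and "n \<ge> 3"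
  shows "\<not> VectorSpace.subspace (class_ring :: 'a ring) (image_z1z2 n) (module_mat TYPE('a) n n)"
proof
  assume "VectorSpace.subspace (class_ring :: 'a ring) (image_z1z2 n) (module_mat TYPE('a) n n)"
  then have closed: "A + B \<in> image_z1z2 n"
    if "A \<in> image_z1z2 n" "B \<in> image_z1z2 n" for A B :: "'a mat"
    using that by (auto simp: VectorSpace.subspace_def submodule_def module_mat_simps)
  have in_image: "A * B \<in> image_z1z2 n" if "A \<in> skew_UT n" "B \<in> skew_UT n" for A B :: "'a mat"
    using that by (auto simp: image_z1z2_def)
  have "corner_sum n \<in> (image_z1z2 n :: 'a mat set)"
    unfolding corner_sum_decomposition[OF assms(2)]
    using assms(2) by (intro closed in_image skew_unit_skew) auto
  with corner_sum_notin_image[OF assms(1), of n] assms(2) show False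
    by simp
qed

end
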